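(* Let $L$ be a countable complemented modular lattice. Then for a Boolean Banaschewski function on $L$ with range $B$, the pair $(B,\Delta|_B)$ is unique up to isomorphism; that is, if $f$ and $f'$ are Boolean Banaschewski functions on $L$ with ranges $B$ and $B'$, respectively, then there exists an isomorphism of Boolean algebras $\varphi\colon B\to B'$ such that $\Delta(\varphi(x))=\Delta(x)$ for each $x\in B$. In particular, $B$ is unique up to isomorphism.
   Context: "Countable" means at most countable. A lattice is complemented if it has $0$ and $1$ and every element has a complement. The notation $a\oplus b=c$ means $a\wedge b=0$ and $a\vee b=c$. A Banaschewski function on a bounded lattice $L$ is an antitone (order-reversing) map $f\colon L\to L$ such that $x\oplus f(x)=1$ for each $x\in L$. It is Boolean if its range is a Boolean sublattice of $L$ (a sublattice that is a Boolean lattice under the induced operations). The dimension monoid $\operatorname{Dim}L$ of a lattice $L$ is the commutative monoid defined by generators $\Delta(a,b)$, for $a\leq b$ in $L$, and the relations: $\Delta(a,a)=0$ for all $a\in L$; $\Delta(a,c)=\Delta(a,b)+\Delta(b,c)$ for all $a\leq b\leq c$ in $L$; $\Delta(a,a\vee b)=\Delta(a\wedge b,b)$ for all $a,b\in L$. If $L$ has a zero, the canonical map $\Delta\colon L\to\operatorname{Dim}L$ is $\Delta(x):=\Delta(0,x)$. *)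

theory Defs
  imports
    "HOL-Library.Countable_Set"
    "HOL-Library.Interval"
    "HOL-Library.Multiset"
begin

section \<open>Complemented modular lattices\<close>

definition direct_sum :: "'a::bounded_lattice_bot \<Rightarrow> 'a \<Rightarrow> 'a \<Rightarrow> bool" where
  "direct_sum a b c \<longleftrightarrow> inf a b = bot \<and> sup a b = c"

text \<open>
  The library class \<open>complemented_lattice\<close> carries a chosen complementation as an operation;
  here only the existence of complements is required.
\<close>

definition complemented :: "'a::bounded_lattice itself \<Rightarrow> bool" where
  "complemented _ \<longleftrightarrow> (\<forall>x::'a. \<exists>y. direct_sum x y top)"

definition modular :: "'a::lattice itself \<Rightarrow> bool" where
  "modular _ \<longleftrightarrow> (\<forall>x y z::'a. x \<le> z \<longrightarrow> sup x (inf y z) = inf (sup x y) z)"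

section \<open>Boolean sublattices and Banaschewski functions\<close>

definition sublattice :: "'a::lattice set \<Rightarrow> bool" where
  "sublattice B \<longleftrightarrow> (\<forall>x\<in>B. \<forall>y\<in>B. inf x y \<in> B \<and> sup x y \<in> B)"

definition bounds_in :: "'a::lattice set \<Rightarrow> 'a \<Rightarrow> 'a \<Rightarrow> bool" where
  "bounds_in B z u \<longleftrightarrow> z \<in> B \<and> u \<in> B \<and> (\<forall>x\<in>B. z \<le> x \<and> x \<le> u)"

definition compl_in :: "'a::lattice set \<Rightarrow> 'a \<Rightarrow> 'a \<Rightarrow> bool" where
  "compl_in B x y \<longleftrightarrow> x \<in> B \<and> y \<in> B \<and> bounds_in B (inf x y) (sup x y)"

text \<open>
  The bounds of a Boolean sublattice are its own, and need not be those of the ambient lattice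
  (for the range of a Banaschewski function they coincide, see below).
\<close>

definition boolean_sublattice :: "'a::lattice set \<Rightarrow> bool" where
  "boolean_sublattice B \<longleftrightarrow>
     sublattice B \<and>
     (\<exists>z u. bounds_in B z u) \<and>
     (\<forall>x\<in>B. \<forall>y\<in>B. \<forall>z\<in>B. inf x (sup y z) = sup (inf x y) (inf x z)) \<and>
     (\<forall>x\<in>B. \<exists>y\<in>B. compl_in B x y)"

definition boolean_iso :: "('a::lattice \<Rightarrow> 'b::lattice) \<Rightarrow> 'a set \<Rightarrow> 'b set \<Rightarrow> bool" where
  "boolean_iso \<phi> B C \<longleftrightarrow>
     bij_betw \<phi> B C \<and>
     (\<forall>x\<in>B. \<forall>y\<in>B. \<phi> (inf x y) = inf (\<phi> x) (\<phi> y)) \<and>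
     (\<forall>x\<in>B. \<forall>y\<in>B. \<phi> (sup x y) = sup (\<phi> x) (\<phi> y)) \<and>
     (\<forall>z u. bounds_in B z u \<longrightarrow> bounds_in C (\<phi> z) (\<phi> u)) \<and>
     (\<forall>x y. compl_in B x y \<longrightarrow> compl_in C (\<phi> x) (\<phi> y))"

definition banaschewski :: "('a::bounded_lattice \<Rightarrow> 'a) \<Rightarrow> bool" where
  "banaschewski f \<longleftrightarrow> antimono f \<and> (\<forall>x. direct_sum x (f x) top)"

definition boolean_banaschewski :: "('a::bounded_lattice \<Rightarrow> 'a) \<Rightarrow> bool" where
  "boolean_banaschewski f \<longleftrightarrow> banaschewski f \<and> boolean_sublattice (range f)"

lemma banaschewski_bounds_in_range:
  assumes "banaschewski f"
  shows "bounds_in (range f) bot top"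
proof -
  have "f top = bot" "f bot = top"
    using assms unfolding banaschewski_def direct_sum_def by (metis inf_top_left, metis sup_bot_left)
  then show ?thesis
    unfolding bounds_in_def by (metis bot_least rangeI top_greatest)
qed

section \<open>The dimension monoid\<close>

text \<open>
  A multiset of closed intervals \<open>Interval (a, b)\<close>, \<open>a \<le> b\<close>, is an element of the free commutative
  monoid on the generators \<open>\<Delta>(a, b)\<close>; \<open>dim_cong\<close> is the monoid congruence generated by the three
  families of defining relations.
\<close>

inductive dim_cong :: "'a::lattice interval multiset \<Rightarrow> 'a interval multiset \<Rightarrow> bool" where
  refl: "dim_cong X X"
| sym: "dim_cong X Y \<Longrightarrow> dim_cong Y X"
| trans: "dim_cong X Y \<Longrightarrow> dim_cong Y Z \<Longrightarrow> dim_cong X Z"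
| add: "dim_cong X Y \<Longrightarrow> dim_cong (X + Z) (Y + Z)"
| point: "dim_cong {#Interval (a, a)#} {#}"
| split: "a \<le> b \<Longrightarrow> b \<le> c \<Longrightarrow>
    dim_cong {#Interval (a, c)#} {#Interval (a, b), Interval (b, c)#}"
| transpose: "dim_cong {#Interval (a, sup a b)#} {#Interval (inf a b, b)#}"

quotient_type (overloaded) 'a dim = "'a::lattice interval multiset" / dim_cong
  by (rule equivpI) (auto simp: reflp_def symp_def transp_def intro: dim_cong.intros)

instantiation dim :: (lattice) comm_monoid_add
begin

lift_definition zero_dim :: "'a dim" is "{#}" .

lift_definition plus_dim :: "'a dim \<Rightarrow> 'a dim \<Rightarrow> 'a dim" is "(+)"
  by (metis add.commute dim_cong.add dim_cong.trans)

instance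
  by standard (transfer, simp add: ac_simps dim_cong.refl)+

end

text \<open>\<open>dim_int a b\<close> is the generator \<open>\<Delta>(a, b)\<close>, meaningful only if \<open>a \<le> b\<close>.\<close>

lift_definition dim_int :: "'a::lattice \<Rightarrow> 'a \<Rightarrow> 'a dim" is "\<lambda>a b. {#Interval (a, b)#}" .

definition dim_of :: "'a::bounded_lattice_bot \<Rightarrow> 'a dim" where
  "dim_of x = dim_int bot x"

lemma dim_int_self: "dim_int a a = 0"
  by transfer (rule dim_cong.point)

lemma dim_int_split: "a \<le> b \<Longrightarrow> b \<le> c \<Longrightarrow> dim_int a c = dim_int a b + dim_int b c"
  by transfer (use dim_cong.split in \<open>simp add: add_mset_commute\<close>)

lemma dim_int_transpose: "dim_int a (sup a b) = dim_int (inf a b) b"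
  by transfer (rule dim_cong.transpose)

text \<open>Universal property of the presentation (existence part).\<close>

lemma dim_universal:
  fixes d :: "'a::lattice \<Rightarrow> 'a \<Rightarrow> 'm::comm_monoid_add"
  assumes point: "\<And>a. d a a = 0"
    and split: "\<And>a b c. a \<le> b \<Longrightarrow> b \<le> c \<Longrightarrow> d a c = d a b + d b c"
    and transpose: "\<And>a b. d a (sup a b) = d (inf a b) b"
  shows "\<exists>h :: 'a dim \<Rightarrow> 'm. h 0 = 0 \<and> (\<forall>p q. h (p + q) = h p + h q) \<and>
           (\<forall>a b. a \<le> b \<longrightarrow> h (dim_int a b) = d a b)"
proof -
  define e where "e X = (\<Sum>i\<in>#X. d (lower i) (upper i))" for X
  have [simp]: "lower (Interval (a, b)) = a" "upper (Interval (a, b)) = b" if "a \<le> b" for a b :: 'a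
    using that by (simp_all add: lower.rep_eq upper.rep_eq Interval_inverse)
  have e: "e X = e Y" if "dim_cong X Y" for X Y
    using that by induction (auto simp: e_def point transpose intro: split order_trans)
  define h where "h p = e (rep_dim p)" for p
  have h_abs: "h (abs_dim X) = e X" for X
    unfolding h_def using e Quotient3_rep_abs[OF Quotient3_dim] dim_cong.refl by blast
  have "h (p + q) = h p + h q" for p q
  proof -
    have "h (abs_dim X + abs_dim Y) = e X + e Y" for X Y
      by (simp add: plus_dim.abs_eq h_abs e_def)
    then show ?thesis
      unfolding h_def by (metis Quotient3_abs_rep[OF Quotient3_dim])
  qed
  moreover have "h 0 = 0"
    by (simp add: zero_dim_def h_abs e_def)
  moreover have "h (dim_int a b) = d a b" if "a \<le> b" for a b
    using that by (simp add: dim_int.abs_eq h_abs e_def)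
  ultimately show ?thesis by blast
qed

end

theory Submission
  imports Defs "HOL-Library.Set_Algebras" "HOL-Library.Product_Plus"
begin

text \<open>
  The theorem is an instance of Vaught's back-and-forth argument. Call a map \<open>\<mu>\<close> from a Boolean
  algebra to a commutative monoid a V-measure if it is additive on disjoint joins, vanishes only at
  \<open>bot\<close>, and lets every equation \<open>\<mu> x = \<alpha> + \<beta>\<close> be realized by a partition of \<open>x\<close> into pieces of
  measures \<open>\<alpha>\<close> and \<open>\<beta>\<close>. Two countable Boolean algebras with V-measures into the same monoid that
  agree at \<open>top\<close> are isomorphic by a measure-preserving map: any finite matching of elements can be
  enlarged by one more element on either side, because a partition of \<open>x\<close> is copied, measure by
  measure, to any \<open>y\<close> of the same measure (\<open>v_measure_pair.vaught\<close>).

  It remains to see that \<open>\<Delta>\<close> is a V-measure on the range \<open>B\<close> of a Boolean Banaschewski function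
  \<open>f\<close>. The point is the splitting property, which holds in two stages.

  In the whole lattice, \<open>\<Delta>(u, v) = \<alpha> + \<beta>\<close> implies \<open>\<Delta>(u, t) = \<alpha>\<close> and \<open>\<Delta>(t, v) = \<beta>\<close> for some \<open>t\<close>
  between \<open>u\<close> and \<open>v\<close> (\<open>dim_int_sum_split\<close>). Sending \<open>[a, b]\<close> to the set of all pairs
  \<open>(\<Delta>(a, t), \<Delta>(t, b))\<close> respects the defining relations of the dimension monoid, sets of pairs being
  added elementwise: modularity makes transposed intervals isomorphic, and relative complements allow
  two adjacent pieces of a chain to be interchanged. So there is a homomorphism \<open>h\<close> from \<open>Dim L\<close> to
  sets of pairs with these values. As \<open>h \<alpha>\<close> contains \<open>(\<alpha>, 0)\<close> and \<open>h \<beta>\<close> contains \<open>(0, \<beta>)\<close>, the pair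
  \<open>(\<alpha>, \<beta>)\<close> lies in \<open>h (\<alpha> + \<beta>) = h (\<Delta>(u, v))\<close>, which is the claim.

  For \<open>x\<close> in \<open>B\<close>, the element \<open>t\<close> obtained for \<open>\<Delta>(bot, x)\<close> need not lie in \<open>B\<close>. But \<open>f t\<close> does, and
  it cuts \<open>x\<close> inside \<open>B\<close> into \<open>z = x \<and> f t\<close> and its complement \<open>y\<close> relative to \<open>x\<close>. By modularity \<open>t\<close>
  is another complement of \<open>z\<close> relative to \<open>x\<close>, so \<open>\<Delta> y = \<Delta> t = \<alpha>\<close> and \<open>\<Delta> z = \<Delta>(t, x) = \<beta>\<close>
  (\<open>boolean_banaschewski_v_measure\<close>).
\<close>

section \<open>Order isomorphisms of sublattices\<close>

text \<open>
  Meets, joins, bounds and complements are all determined by the order, so the back-and-forth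
  construction needs to control comparisons only.
\<close>

lemma order_iso_imp_boolean_iso:
  fixes \<phi> :: "'a::lattice \<Rightarrow> 'b::lattice"
  assumes bij: "bij_betw \<phi> A B"
    and le: "\<And>x y. x \<in> A \<Longrightarrow> y \<in> A \<Longrightarrow> \<phi> x \<le> \<phi> y \<longleftrightarrow> x \<le> y"
    and A: "sublattice A" and B: "sublattice B"
  shows "boolean_iso \<phi> A B"
proof -
  have mem: "\<phi> x \<in> B" if "x \<in> A" for x
    using bij that by (rule bij_betwE[rule_format])
  have surj: "\<exists>x\<in>A. \<phi> x = y" if "y \<in> B" for y
    using bij that by (auto simp: bij_betw_def)
  have closed: "inf x y \<in> A" "sup x y \<in> A" if "x \<in> A" "y \<in> A" for x y
    using A that by (auto simp: sublattice_def)
  have inf: "\<phi> (inf x y) = inf (\<phi> x) (\<phi> y)" if xy: "x \<in> A" "y \<in> A" for x y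
  proof (rule antisym)
    show "\<phi> (inf x y) \<le> inf (\<phi> x) (\<phi> y)"
      using xy closed by (simp add: le)
    have "inf (\<phi> x) (\<phi> y) \<in> B"
      using B mem xy by (simp add: sublattice_def)
    then obtain z where z: "z \<in> A" "\<phi> z = inf (\<phi> x) (\<phi> y)"
      using surj by blast
    then have "z \<le> inf x y"
      using xy by (metis inf.cobounded1 inf.cobounded2 le inf_greatest)
    then show "inf (\<phi> x) (\<phi> y) \<le> \<phi> (inf x y)"
      using z xy closed by (metis le)
  qed
  have sup: "\<phi> (sup x y) = sup (\<phi> x) (\<phi> y)" if xy: "x \<in> A" "y \<in> A" for x y
  proof (rule antisym)
    show "sup (\<phi> x) (\<phi> y) \<le> \<phi> (sup x y)"
      using xy closed by (simp add: le)
    have "sup (\<phi> x) (\<phi> y) \<in> B"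
      using B mem xy by (simp add: sublattice_def)
    then obtain z where z: "z \<in> A" "\<phi> z = sup (\<phi> x) (\<phi> y)"
      using surj by blast
    then have "sup x y \<le> z"
      using xy by (metis sup.cobounded1 sup.cobounded2 le sup_least)
    then show "\<phi> (sup x y) \<le> sup (\<phi> x) (\<phi> y)"
      using z xy closed by (metis le)
  qed
  have bounds: "bounds_in B (\<phi> z) (\<phi> u)" if "bounds_in A z u" for z u
    unfolding bounds_in_def
  proof (intro conjI ballI)
    fix y assume "y \<in> B"
    then obtain x where "x \<in> A" "\<phi> x = y"
      using surj by blast
    then show "\<phi> z \<le> y" "y \<le> \<phi> u"
      using that le by (auto simp: bounds_in_def)
  qed (use that mem in \<open>auto simp: bounds_in_def\<close>)
  have "compl_in B (\<phi> x) (\<phi> y)" if "compl_in A x y" for x y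
    using that bounds[of "inf x y" "sup x y"] by (simp add: compl_in_def mem inf sup)
  then show ?thesis
    using bij inf sup bounds by (simp add: boolean_iso_def)
qed

section \<open>Measures on Boolean sublattices and Vaught's theorem\<close>

lemma direct_sum_commute: "direct_sum a b c \<longleftrightarrow> direct_sum b a c"
  by (simp add: direct_sum_def inf_commute sup_commute)

text \<open>
  A Boolean algebra sits inside an ambient lattice that need not be distributive, hence
  distributivity is available on the carrier \<open>B\<close> only. The complement is a parameter \<open>n\<close>, which for
  the range of a Banaschewski function is that function itself.
\<close>

locale v_measure =
  fixes B :: "'a::bounded_lattice set"
    and n :: "'a \<Rightarrow> 'a"
    and \<mu> :: "'a \<Rightarrow> 'm::comm_monoid_add"
  assumes top_in [simp, intro]: "top \<in> B"
    and inf_in [simp, intro]: "x \<in> B \<Longrightarrow> y \<in> B \<Longrightarrow> inf x y \<in> B"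
    and sup_in [simp, intro]: "x \<in> B \<Longrightarrow> y \<in> B \<Longrightarrow> sup x y \<in> B"
    and distrib: "x \<in> B \<Longrightarrow> y \<in> B \<Longrightarrow> z \<in> B \<Longrightarrow> inf x (sup y z) = sup (inf x y) (inf x z)"
    and compl_in [simp, intro]: "x \<in> B \<Longrightarrow> n x \<in> B"
    and compl: "x \<in> B \<Longrightarrow> direct_sum x (n x) top"
    and zero: "x \<in> B \<Longrightarrow> \<mu> x = 0 \<longleftrightarrow> x = bot"
    and add: "x \<in> B \<Longrightarrow> y \<in> B \<Longrightarrow> direct_sum x y z \<Longrightarrow> \<mu> z = \<mu> x + \<mu> y"
    and split: "x \<in> B \<Longrightarrow> \<mu> x = \<alpha> + \<beta> \<Longrightarrow>
      \<exists>y\<in>B. \<exists>z\<in>B. direct_sum y z x \<and> \<mu> y = \<alpha> \<and> \<mu> z = \<beta>"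
begin

lemma direct_sum_inf:
  assumes "x \<in> B" "y \<in> B" "z \<in> B" "direct_sum y z w"
  shows "direct_sum (inf x y) (inf x z) (inf x w)"
proof -
  have "inf (inf x y) (inf x z) = inf x (inf y z)"
    by (simp add: inf.assoc inf.left_commute)
  then show ?thesis
    using assms distrib[of x y z] by (auto simp: direct_sum_def)
qed

lemma direct_sum_cut: "x \<in> B \<Longrightarrow> b \<in> B \<Longrightarrow> direct_sum (inf x b) (inf x (n b)) x"
  using direct_sum_inf[of x b "n b" top] compl[of b] by simp

lemma le_iff_measure:
  assumes "x \<in> B" "b \<in> B"
  shows "x \<le> b \<longleftrightarrow> \<mu> (inf x (n b)) = 0"
proof -
  have "x \<le> b \<longleftrightarrow> inf x (n b) = bot"
  proof
    assume "x \<le> b"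
    then have "inf x (n b) \<le> inf b (n b)"
      by (simp add: le_infI1)
    then show "inf x (n b) = bot"
      using compl[OF \<open>b \<in> B\<close>] by (metis direct_sum_def bot_unique)
  next
    assume "inf x (n b) = bot"
    then have "x = inf x b"
      using direct_sum_cut[OF assms] by (simp add: direct_sum_def)
    then show "x \<le> b"
      by (simp add: le_iff_inf)
  qed
  then show ?thesis
    using assms zero by simp
qed

text \<open>
  Partitions of the two parts of \<open>y\<close> cut out by \<open>b\<close> combine to a partition of \<open>y\<close>, and \<open>b\<close> recovers the
  original parts. This is the step of the induction that copies a partition across a matching.
\<close>

lemma direct_sum_glue:
  assumes y: "y \<in> B" and b: "b \<in> B"
    and u: "u1 \<in> B" "u2 \<in> B" "direct_sum u1 u2 (inf y b)"
    and v: "v1 \<in> B" "v2 \<in> B" "direct_sum v1 v2 (inf y (n b))"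
  shows "direct_sum (sup u1 v1) (sup u2 v2) y"
    and "inf (sup u1 v1) b = u1" and "inf (sup u1 v1) (n b) = v1"
proof -
  have le: "u1 \<le> b" "u2 \<le> b" "v1 \<le> n b" "v2 \<le> n b"
    using u v by (metis direct_sum_def le_inf_iff sup_ge1 sup_ge2)+
  have bn: "inf b (n b) = bot"
    using compl[OF b] by (simp add: direct_sum_def)
  have disj: "inf p q = bot" if "p \<le> b" "q \<le> n b" for p q
    using inf_mono[OF that] bn by (simp add: bot_unique)
  have disj': "inf q p = bot" if "p \<le> b" "q \<le> n b" for p q
    using disj[OF that] by (simp add: inf_commute)
  have "inf b (sup u1 v1) = u1"
    using b u v le by (simp add: distrib disj inf_absorb2)
  then show "inf (sup u1 v1) b = u1"
    by (simp add: inf_commute)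
  have "inf (n b) (sup u1 v1) = v1"
    using b u v le by (simp add: distrib disj' inf_absorb2)
  then show "inf (sup u1 v1) (n b) = v1"
    by (simp add: inf_commute)
  have "inf (sup u1 v1) u2 = sup (inf u2 u1) (inf u2 v1)"
    "inf (sup u1 v1) v2 = sup (inf v2 u1) (inf v2 v1)"
    using u v by (simp_all add: distrib inf_commute[of "sup u1 v1"])
  moreover have "inf (sup u1 v1) (sup u2 v2) = sup (inf (sup u1 v1) u2) (inf (sup u1 v1) v2)"
    using u v by (simp add: distrib)
  moreover have "inf u2 u1 = bot" "inf v2 v1 = bot"
    using u v by (simp_all add: direct_sum_def inf_commute)
  ultimately have "inf (sup u1 v1) (sup u2 v2) = bot"
    using le by (simp add: disj disj')
  moreover have "sup (sup u1 v1) (sup u2 v2) = y"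
  proof -
    have "sup (sup u1 v1) (sup u2 v2) = sup (sup u1 u2) (sup v1 v2)"
      by (simp add: sup.assoc sup.left_commute)
    then show ?thesis
      using u v direct_sum_cut[OF y b] by (simp add: direct_sum_def)
  qed
  ultimately show "direct_sum (sup u1 v1) (sup u2 v2) y"
    by (simp add: direct_sum_def)
qed

end

locale v_measure_pair =
  A: v_measure A n \<mu> + B: v_measure B n' \<nu>
  for A :: "'a::bounded_lattice set" and n and \<mu> :: "'a \<Rightarrow> 'm::comm_monoid_add"
    and B :: "'b::bounded_lattice set" and n' and \<nu> :: "'b \<Rightarrow> 'm"
begin

text \<open>
  \<open>matched x y [(a\<^sub>1, b\<^sub>1), \<dots>, (a\<^sub>k, b\<^sub>k)]\<close> says that each of the \<open>2\<^sup>k\<close> cells into which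
  \<open>a\<^sub>1, \<dots>, a\<^sub>k\<close> cut \<open>x\<close> has the same measure as the corresponding cell of \<open>y\<close>. For \<open>x = y = top\<close>
  this means that \<open>a\<^sub>i \<mapsto> b\<^sub>i\<close> extends to a measure-preserving isomorphism of the finite subalgebras
  generated by the two families. The recursion makes cutting by a further pair a mere \<open>Cons\<close>.
\<close>

fun matched :: "'a \<Rightarrow> 'b \<Rightarrow> ('a \<times> 'b) list \<Rightarrow> bool" where
  "matched x y [] \<longleftrightarrow> \<mu> x = \<nu> y"
| "matched x y ((a, b) # ps) \<longleftrightarrow>
     matched (inf x a) (inf y b) ps \<and> matched (inf x (n a)) (inf y (n' b)) ps"

lemma matched_imp_measure_eq:
  assumes "matched x y ps" "x \<in> A" "y \<in> B" "set ps \<subseteq> A \<times> B"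
  shows "\<mu> x = \<nu> y"
  using assms
proof (induction x y ps rule: matched.induct)
  case (2 x y a b ps)
  then have mem: "a \<in> A" "b \<in> B"
    by auto
  have "\<mu> x = \<mu> (inf x a) + \<mu> (inf x (n a))"
    using A.add[OF _ _ A.direct_sum_cut[OF 2(4) mem(1)]] 2(4) mem by blast
  moreover have "\<nu> y = \<nu> (inf y b) + \<nu> (inf y (n' b))"
    using B.add[OF _ _ B.direct_sum_cut[OF 2(5) mem(2)]] 2(5) mem by blast
  ultimately show ?case
    using 2 mem by simp
qed simp

lemma matched_bot: "matched bot bot ps"
proof (induction ps)
  case Nil
  have "bot \<in> A" "bot \<in> B"
    using A.compl[OF A.top_in] A.compl_in[OF A.top_in] B.compl[OF B.top_in] B.compl_in[OF B.top_in]
    by (simp_all add: direct_sum_def)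
  then show ?case
    using A.zero[of bot] B.zero[of bot] by simp
qed auto

text \<open>
  Cutting by a pair that is already in the list yields no new cells except empty ones. Used twice,
  this compares the measures of \<open>a\<close> and \<open>b\<close>, and of \<open>a \<and> \<not> c\<close> and \<open>b \<and> \<not> d\<close>, for listed pairs
  \<open>(a, b)\<close> and \<open>(c, d)\<close>.
\<close>

lemma matched_cut:
  assumes "matched x y ps" "set ps \<subseteq> A \<times> B" "(a, b) \<in> set ps"
  shows "matched (inf x a) (inf y b) ps \<and> matched (inf x (n a)) (inf y (n' b)) ps"
  using assms
proof (induction x y ps rule: matched.induct)
  case (2 x y c d ps)
  show ?case
  proof (cases "(a, b) = (c, d)")
    case True
    have ab: "inf a (n a) = bot" "inf (n a) a = bot" "inf b (n' b) = bot" "inf (n' b) b = bot"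
      using 2 A.compl[of a] B.compl[of b] by (auto simp: direct_sum_def inf_commute)
    show ?thesis
      using 2 True ab by (simp add: inf.assoc matched_bot)
  next
    case False
    then show ?thesis
      using 2 by (auto simp: inf.assoc inf.left_commute inf_commute)
  qed
qed simp

text \<open>
  The heart of the extension step: a partition of \<open>x\<close> is copied to \<open>y\<close> cell by cell. In a single cell
  this is the splitting property of \<open>\<nu>\<close>, applied to \<open>\<nu> y = \<mu> x = \<mu> x1 + \<mu> x2\<close>.
\<close>

lemma matched_split:
  assumes "matched x y ps" "set ps \<subseteq> A \<times> B" "x \<in> A" "y \<in> B"
    and "x1 \<in> A" "x2 \<in> A" "direct_sum x1 x2 x"
  shows "\<exists>y1\<in>B. \<exists>y2\<in>B. direct_sum y1 y2 y \<and> matched x1 y1 ps \<and> matched x2 y2 ps"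
  using assms
proof (induction x y ps arbitrary: x1 x2 rule: matched.induct)
  case (1 x y)
  then have "\<nu> y = \<mu> x1 + \<mu> x2"
    using A.add by simp
  then show ?case
    using B.split[OF \<open>y \<in> B\<close>] by fastforce
next
  case (2 x y a b ps)
  have ab: "a \<in> A" "b \<in> B"
    using 2 by auto
  have sums: "direct_sum (inf x1 c) (inf x2 c) (inf x c)" if "c \<in> A" for c
    using A.direct_sum_inf[OF that 2(7,8,9)] by (simp add: inf_commute)
  obtain u1 u2 where u: "u1 \<in> B" "u2 \<in> B" "direct_sum u1 u2 (inf y b)"
      "matched (inf x1 a) u1 ps" "matched (inf x2 a) u2 ps"
    using 2(1)[of "inf x1 a" "inf x2 a"] 2(3-8) sums[of a] ab by auto
  obtain v1 v2 where v: "v1 \<in> B" "v2 \<in> B" "direct_sum v1 v2 (inf y (n' b))"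
      "matched (inf x1 (n a)) v1 ps" "matched (inf x2 (n a)) v2 ps"
    using 2(2)[of "inf x1 (n a)" "inf x2 (n a)"] 2(3-8) sums[of "n a"] ab by auto
  have u': "direct_sum u2 u1 (inf y b)" and v': "direct_sum v2 v1 (inf y (n' b))"
    using u v by (simp_all add: direct_sum_commute)
  note 12 = B.direct_sum_glue[OF \<open>y \<in> B\<close> \<open>b \<in> B\<close> u(1-3) v(1-3)]
    and 21 = B.direct_sum_glue[OF \<open>y \<in> B\<close> \<open>b \<in> B\<close> u(2,1) u' v(2,1) v']
  show ?case
  proof (intro bexI conjI)
    show "direct_sum (sup u1 v1) (sup u2 v2) y"
      by (rule 12)
    show "matched x1 (sup u1 v1) ((a, b) # ps)" "matched x2 (sup u2 v2) ((a, b) # ps)"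
      using u v by (simp_all add: 12 21)
  qed (use u v in auto)
qed

lemma matched_forth:
  assumes "matched top top ps" "set ps \<subseteq> A \<times> B" "a \<in> A"
  shows "\<exists>b\<in>B. matched top top ((a, b) # ps)"
proof -
  obtain b c where bc: "b \<in> B" "c \<in> B" "direct_sum b c top" "matched a b ps" "matched (n a) c ps"
    using matched_split[OF assms(1,2) A.top_in B.top_in assms(3) A.compl_in A.compl] assms(3) by blast
  \<comment> \<open>Complements in \<open>B\<close> are unique, so \<open>b\<close> alone determines the partition of \<open>top\<close>.\<close>
  have "c = inf c (n' b)"
    using bc B.direct_sum_cut[of c b] by (simp add: direct_sum_def inf_commute)
  moreover have "n' b = inf (n' b) c"
    using bc B.direct_sum_cut[of "n' b" c] B.direct_sum_inf[of "n' b" b c top] B.compl[of b]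
    by (simp add: direct_sum_def inf_commute)
  ultimately have "c = n' b"
    by (simp add: inf_commute)
  then show ?thesis
    using bc by auto
qed

interpretation swapped: v_measure_pair B n' \<nu> A n \<mu> ..

lemma swapped_matched: "swapped.matched y x (map prod.swap ps) \<longleftrightarrow> matched x y ps"
  by (induction x y ps rule: matched.induct) auto

lemma matched_back:
  assumes "matched top top ps" "set ps \<subseteq> A \<times> B" "b \<in> B"
  shows "\<exists>a\<in>A. matched top top ((a, b) # ps)"
proof -
  have "set (map prod.swap ps) \<subseteq> B \<times> A"
    using assms(2) by auto
  then obtain a where "a \<in> A" "swapped.matched top top ((b, a) # map prod.swap ps)"
    using swapped.matched_forth[of "map prod.swap ps" b] assms swapped_matched by blast
  then show ?thesis
    using swapped_matched[of top top "(a, b) # ps" for a] by auto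
qed

text \<open>
  A countable chain of matchings, each enlarged by the next element of either side, exhausts both
  algebras. Its union is the graph of an order isomorphism, since \<open>a \<le> c\<close> holds iff \<open>a \<and> \<not> c\<close> has
  measure \<open>0\<close>, and matched pairs agree on such measures.
\<close>

theorem vaught:
  assumes "countable A" "countable B" "\<mu> top = \<nu> top"
  shows "\<exists>\<phi>. boolean_iso \<phi> A B \<and> (\<forall>x\<in>A. \<nu> (\<phi> x) = \<mu> x)"
proof -
  define good where "good ps \<longleftrightarrow> matched top top ps \<and> set ps \<subseteq> A \<times> B" for ps
  define grows where "grows k ps qs \<longleftrightarrow> set ps \<subseteq> set qs \<and>
      from_nat_into A k \<in> fst ` set qs \<and> from_nat_into B k \<in> snd ` set qs" for k ps qs
  have "\<exists>P. \<forall>k. good (P k) \<and> grows k (P k) (P (Suc k))"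
  proof (rule dependent_nat_choice[of "\<lambda>_. good" grows])
    show "\<exists>ps. good ps"
      using assms(3) by (intro exI[of _ "[]"]) (simp add: good_def)
  next
    fix ps k assume ps: "good ps"
    have mem: "from_nat_into A k \<in> A" "from_nat_into B k \<in> B"
      using A.top_in B.top_in by (auto intro!: from_nat_into)
    obtain b where b: "b \<in> B" "matched top top ((from_nat_into A k, b) # ps)"
      using matched_forth[of ps "from_nat_into A k"] ps mem unfolding good_def by blast
    define qs where "qs = (from_nat_into A k, b) # ps"
    have qs: "matched top top qs" "set qs \<subseteq> A \<times> B"
      using b mem ps by (auto simp: qs_def good_def)
    obtain a where a: "a \<in> A" "matched top top ((a, from_nat_into B k) # qs)"
      using matched_back[OF qs mem(2)] by blast
    show "\<exists>rs. good rs \<and> grows k ps rs"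
      by (rule exI[of _ "(a, from_nat_into B k) # qs"])
        (use a mem qs in \<open>auto simp: good_def grows_def qs_def\<close>)
  qed
  then obtain P where step: "\<forall>k. good (P k) \<and> grows k (P k) (P (Suc k))" ..
  then have P: "good (P k)"
    and inc: "set (P k) \<subseteq> set (P (Suc k))"
    and A_cov: "from_nat_into A k \<in> fst ` set (P (Suc k))"
    and B_cov: "from_nat_into B k \<in> snd ` set (P (Suc k))" for k
    by (auto simp: grows_def)
  define R where "R = (\<Union>k. set (P k))"
  have mono: "set (P i) \<subseteq> set (P j)" if "i \<le> j" for i j
    using that inc by (rule lift_Suc_mono_le[of "\<lambda>k. set (P k)", rotated])
  have common: "\<exists>k. {p, q} \<subseteq> set (P k)" if pq: "p \<in> R" "q \<in> R" for p q
  proof -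
    obtain i j where "p \<in> set (P i)" "q \<in> set (P j)"
      using pq by (auto simp: R_def)
    then show ?thesis
      using mono[of i "max i j"] mono[of j "max i j"] by auto
  qed
  have R_sub: "R \<subseteq> A \<times> B"
    using P by (auto simp: R_def good_def)
  have A_tot: "\<exists>b. (a, b) \<in> R" if "a \<in> A" for a
  proof -
    obtain k where "from_nat_into A k = a"
      using from_nat_into_surj[OF assms(1) \<open>a \<in> A\<close>] by blast
    then show ?thesis
      using A_cov[of k] unfolding R_def by fastforce
  qed
  have B_tot: "\<exists>a. (a, b) \<in> R" if "b \<in> B" for b
  proof -
    obtain k where "from_nat_into B k = b"
      using from_nat_into_surj[OF assms(2) \<open>b \<in> B\<close>] by blast
    then show ?thesis
      using B_cov[of k] unfolding R_def by fastforce
  qed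
  have R_le: "a \<le> c \<longleftrightarrow> b \<le> d" and R_meas: "\<mu> a = \<nu> b"
    if ab_cd: "(a, b) \<in> R" "(c, d) \<in> R" for a b c d
  proof -
    obtain k where k: "(a, b) \<in> set (P k)" "(c, d) \<in> set (P k)"
      using common[OF ab_cd] by auto
    have mem: "a \<in> A" "c \<in> A" "b \<in> B" "d \<in> B"
      using ab_cd R_sub by auto
    have Pk: "matched top top (P k)" "set (P k) \<subseteq> A \<times> B"
      using P[of k] by (simp_all add: good_def)
    have ab: "matched a b (P k)"
      using matched_cut[OF Pk k(1)] by simp
    then show "\<mu> a = \<nu> b"
      using matched_imp_measure_eq Pk mem by blast
    have "matched (inf a (n c)) (inf b (n' d)) (P k)"
      using matched_cut[OF ab Pk(2) k(2)] by blast
    then have "\<mu> (inf a (n c)) = \<nu> (inf b (n' d))"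
      using matched_imp_measure_eq Pk mem by blast
    then show "a \<le> c \<longleftrightarrow> b \<le> d"
      using mem by (simp add: A.le_iff_measure B.le_iff_measure)
  qed
  obtain \<phi> where \<phi>: "\<And>a. a \<in> A \<Longrightarrow> (a, \<phi> a) \<in> R"
    using A_tot by metis
  have le: "\<phi> x \<le> \<phi> y \<longleftrightarrow> x \<le> y" if "x \<in> A" "y \<in> A" for x y
    using R_le[OF \<phi>[OF that(1)] \<phi>[OF that(2)]] by simp
  have "bij_betw \<phi> A B"
  proof (rule bij_betw_imageI)
    show "inj_on \<phi> A"
      using le by (intro inj_onI antisym) (metis order_refl)+
    show "\<phi> ` A = B"
    proof
      show "\<phi> ` A \<subseteq> B"
        using \<phi> R_sub by auto
      show "B \<subseteq> \<phi> ` A"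
      proof
        fix b assume "b \<in> B"
        then obtain a where a: "(a, b) \<in> R"
          using B_tot by blast
        then have "a \<in> A"
          using R_sub by auto
        then have "\<phi> a = b"
          using R_le[OF a \<phi>] R_le[OF \<phi> a] by (intro antisym) blast+
        then show "b \<in> \<phi> ` A"
          using \<open>a \<in> A\<close> by blast
      qed
    qed
  qed
  moreover have "sublattice A" "sublattice B"
    by (auto simp: sublattice_def)
  ultimately have "boolean_iso \<phi> A B"
    using le by (intro order_iso_imp_boolean_iso)
  moreover have "\<nu> (\<phi> x) = \<mu> x" if "x \<in> A" for x
    using R_meas[OF \<phi>[OF that] \<phi>[OF that]] by simp
  ultimately show ?thesis
    by blast
qed

end

section \<open>Splitting in the dimension monoid\<close>

lemma relative_complement:
  fixes a b c :: "'a::bounded_lattice"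
  assumes L: "complemented TYPE('a)" "modular TYPE('a)" and "a \<le> b" "b \<le> c"
  shows "\<exists>s. inf b s = a \<and> sup b s = c"
proof -
  obtain b' where b': "inf b b' = bot" "sup b b' = top"
    using L(1) by (auto simp: complemented_def direct_sum_def)
  have modular: "sup x (inf y z) = inf (sup x y) z" if "x \<le> z" for x y z :: 'a
    using L(2) that by (auto simp: modular_def)
  define s where "s = inf (sup a b') c"
  have "inf b s = inf (sup a b') b"
    unfolding s_def using inf.absorb1[OF \<open>b \<le> c\<close>] by (metis inf.assoc inf_commute)
  also have "\<dots> = a"
    using modular[OF \<open>a \<le> b\<close>, of b'] b' by (simp add: inf_commute)
  finally have "inf b s = a" .
  moreover have "sup b s = c"
  proof -
    have "sup b s = inf (sup b (sup a b')) c"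
      using modular[OF \<open>b \<le> c\<close>] by (simp add: s_def)
    also have "sup b (sup a b') = top"
      using b' by (simp add: sup.left_commute)
    finally show ?thesis by simp
  qed
  ultimately show ?thesis by blast
qed

lemma dim_induct [case_names zero add]:
  assumes "Q 0" and "\<And>a b p. a \<le> b \<Longrightarrow> Q p \<Longrightarrow> Q (dim_int a b + p)"
  shows "Q p"
proof -
  have "Q (abs_dim X)" for X
  proof (induction X)
    case empty
    then show ?case using assms(1) by (simp add: zero_dim_def)
  next
    case (add i X)
    have "Interval (lower i, upper i) = i"
      by (simp add: lower_def upper_def bounds_of_interval_inverse)
    then have "abs_dim (add_mset i X) = dim_int (lower i) (upper i) + abs_dim X"
      by (simp add: dim_int.abs_eq plus_dim.abs_eq)
    then show ?case
      using assms(2)[OF lower_le_upper add.IH] by simp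
  qed
  then show ?thesis
    by (metis Quotient3_abs_rep[OF Quotient3_dim])
qed

text \<open>
  No relation equates a proper interval with a trivial one. To separate them it suffices to map into
  a two-element monoid in which the image of all proper intervals is absorbing; here its elements are
  \<open>0 = {0}\<close> and \<open>{}\<close> under elementwise addition.
\<close>

lemma dim_int_eq_0_iff:
  fixes a b :: "'a::lattice"
  assumes "a \<le> b"
  shows "dim_int a b = 0 \<longleftrightarrow> a = b"
proof
  define d :: "'a \<Rightarrow> 'a \<Rightarrow> nat set" where "d x y = (if x = y then 0 else {})" for x y
  have "\<exists>h. h 0 = 0 \<and> (\<forall>p q. h (p + q) = h p + h q) \<and>
           (\<forall>a b. a \<le> b \<longrightarrow> h (dim_int a b) = d a b)"
    (is "\<exists>h. ?hom h")
  proof (rule dim_universal)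
    show "d x z = d x y + d y z" if "x \<le> y" "y \<le> z" for x y z
      by (cases "x = y"; cases "y = z") (use that in \<open>auto simp: d_def set_plus_def dest: antisym\<close>)
    have "x = sup x y \<longleftrightarrow> inf x y = y" for x y :: 'a
      by (metis inf.absorb_iff2 sup.absorb_iff1)
    then show "d x (sup x y) = d (inf x y) y" for x y
      by (simp add: d_def)
  qed (simp add: d_def)
  then obtain h where h: "?hom h" ..
  assume "dim_int a b = 0"
  have "d a b = h (dim_int a b)"
    using h assms by simp
  also have "\<dots> = 0"
    using h \<open>dim_int a b = 0\<close> by simp
  finally show "a = b"
    by (auto simp: d_def split: if_splits)
qed (simp add: dim_int_self)

text \<open>
  The set \<open>d a b\<close> below collects the ways in which an intermediate element splits \<open>\<Delta>(a, b)\<close>. Once \<open>d\<close> is known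
  to satisfy the defining relations, the universal property extends it to all of \<open>Dim L\<close>, where the
  trivial splittings \<open>(\<alpha>, 0)\<close> and \<open>(0, \<beta>)\<close> add up to the splitting \<open>(\<alpha>, \<beta>)\<close> of \<open>\<alpha> + \<beta>\<close>.
\<close>

lemma dim_int_sum_split:
  fixes u v :: "'a::bounded_lattice"
  assumes L: "complemented TYPE('a)" "modular TYPE('a)"
    and "u \<le> v" and eq: "dim_int u v = \<alpha> + \<beta>"
  shows "\<exists>t. u \<le> t \<and> t \<le> v \<and> dim_int u t = \<alpha> \<and> dim_int t v = \<beta>"
proof -
  have modular: "sup x (inf y z) = inf (sup x y) z" if "x \<le> z" for x y z :: 'a
    using L(2) that by (auto simp: modular_def)
  define d :: "'a \<Rightarrow> 'a \<Rightarrow> ('a dim \<times> 'a dim) set"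
    where "d a b = {(dim_int a t, dim_int t b) | t. a \<le> t \<and> t \<le> b}" for a b
  have dI: "(dim_int a t, dim_int t b) \<in> d a b" if "a \<le> t" "t \<le> b" for a b t
    using that by (auto simp: d_def)
  have "\<exists>h. h 0 = 0 \<and> (\<forall>p q. h (p + q) = h p + h q) \<and>
           (\<forall>a b. a \<le> b \<longrightarrow> h (dim_int a b) = d a b)"
    (is "\<exists>h. ?hom h")
  proof (rule dim_universal)
    show "d a a = 0" for a
      by (auto simp: d_def zero_prod_def dim_int_self dest: antisym intro!: exI[of _ a])
  next
    fix a b c :: 'a assume abc: "a \<le> b" "b \<le> c"
    show "d a c = d a b + d b c"
    proof (intro equalityI subsetI)
      fix w assume "w \<in> d a c"
      then obtain t where t: "a \<le> t" "t \<le> c" "w = (dim_int a t, dim_int t c)"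
        by (auto simp: d_def)
      \<comment> \<open>Push \<open>t\<close> into each half as \<open>b \<and> t\<close> and \<open>b \<or> t\<close>; the discrepancies \<open>[b \<and> t, t]\<close> and
          \<open>[t, b \<or> t]\<close> are transposes of the missing pieces.\<close>
      have "dim_int a t = dim_int a (inf b t) + dim_int (inf b t) t"
        using abc t by (intro dim_int_split) auto
      then have "dim_int a t = dim_int a (inf b t) + dim_int b (sup b t)"
        by (simp add: dim_int_transpose)
      moreover have "dim_int t c = dim_int t (sup t b) + dim_int (sup t b) c"
        using abc t by (intro dim_int_split) auto
      then have "dim_int t c = dim_int (inf b t) b + dim_int (sup b t) c"
        using dim_int_transpose[of t b] by (simp add: inf_commute sup_commute)
      ultimately have "w = (dim_int a (inf b t), dim_int (inf b t) b) +
          (dim_int b (sup b t), dim_int (sup b t) c)"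
        using t by simp
      moreover have "(dim_int a (inf b t), dim_int (inf b t) b) \<in> d a b"
        "(dim_int b (sup b t), dim_int (sup b t) c) \<in> d b c"
        by (rule dI; use abc t in simp)+
      ultimately show "w \<in> d a b + d b c"
        by (simp only: set_plus_intro)
    next
      fix w assume "w \<in> d a b + d b c"
      then obtain r t where r: "a \<le> r" "r \<le> b" and t: "b \<le> t" "t \<le> c"
        and w: "w = (dim_int a r + dim_int b t, dim_int r b + dim_int t c)"
        by (auto simp: d_def elim!: set_plus_elim)
      \<comment> \<open>In the chain \<open>a \<le> r \<le> b \<le> t \<le> c\<close> the two middle pieces stand in the wrong order. Replacing
          \<open>b\<close> by its complement \<open>s\<close> in \<open>[r, t]\<close> interchanges their values.\<close>
      obtain s where s: "inf b s = r" "sup b s = t"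
        using relative_complement[OF L r(2) t(1)] by blast
      have le: "r \<le> s" "s \<le> t"
        using s by auto
      have "dim_int b t = dim_int r s" "dim_int r b = dim_int s t"
        using dim_int_transpose[of b s] dim_int_transpose[of s b] s
        by (simp_all add: inf_commute sup_commute)
      then have "w = (dim_int a s, dim_int s c)"
        using w dim_int_split[OF r(1) le(1)] dim_int_split[OF le(2) t(2)] by simp
      then show "w \<in> d a c"
        using dI[OF order_trans[OF r(1) le(1)] order_trans[OF le(2) t(2)]] by simp
    qed
  next
    fix a b :: 'a
    \<comment> \<open>The mutually inverse maps are \<open>t \<mapsto> b \<and> t\<close> and \<open>t \<mapsto> a \<or> t\<close>.\<close>
    show "d a (sup a b) = d (inf a b) b"
    proof (intro equalityI subsetI)
      fix w assume "w \<in> d a (sup a b)"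
      then obtain t where t: "a \<le> t" "t \<le> sup a b" "w = (dim_int a t, dim_int t (sup a b))"
        by (auto simp: d_def)
      have 1: "sup a (inf b t) = t"
        using modular[OF t(1)] t(2) by (simp add: inf_absorb2)
      have 2: "sup t b = sup a b"
        using t by (intro antisym) (auto intro: le_supI1)
      have "dim_int a t = dim_int (inf a b) (inf b t)"
        using dim_int_transpose[of a "inf b t"] 1 inf.absorb1[OF t(1)]
        by (metis inf.assoc inf_commute)
      moreover have "dim_int t (sup a b) = dim_int (inf b t) b"
        using dim_int_transpose[of t b] 2 by (simp add: inf_commute)
      ultimately show "w \<in> d (inf a b) b"
        using t dI[of "inf a b" "inf b t" b] by (simp add: le_infI1)
    next
      fix w assume "w \<in> d (inf a b) b"
      then obtain t where t: "inf a b \<le> t" "t \<le> b" "w = (dim_int (inf a b) t, dim_int t b)"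
        by (auto simp: d_def)
      have 1: "inf a t = inf a b"
        using t by (intro antisym) (auto intro: le_infI2)
      have 2: "inf (sup a t) b = t"
        using modular[OF t(2), of a] t(1) by (simp add: sup_absorb1 sup_commute)
      have 3: "sup (sup a t) b = sup a b"
        using t(2) by (simp add: sup.assoc sup_absorb2)
      have "dim_int (inf a b) t = dim_int a (sup a t)"
        using dim_int_transpose[of a t] 1 by simp
      moreover have "dim_int t b = dim_int (sup a t) (sup a b)"
        using dim_int_transpose[of "sup a t" b] 2 3 by simp
      ultimately show "w \<in> d a (sup a b)"
        using t dI[of a "sup a t" "sup a b"] by (simp add: le_supI2)
    qed
  qed
  then obtain h where h: "?hom h" ..
  have left: "(p, 0) \<in> h p" for p
  proof (induction p rule: dim_induct)
    case (add a b p)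
    have "(dim_int a b, 0) \<in> d a b"
      using dI[of a b b] add(1) by (simp add: dim_int_self)
    then show ?case
      using set_plus_intro[OF _ add(2)] add(1) by (fastforce simp: h)
  qed (simp add: h zero_prod_def)
  have right: "(0, p) \<in> h p" for p
  proof (induction p rule: dim_induct)
    case (add a b p)
    have "(0, dim_int a b) \<in> d a b"
      using dI[of a a b] add(1) by (simp add: dim_int_self)
    then show ?case
      using set_plus_intro[OF _ add(2)] add(1) by (fastforce simp: h)
  qed (simp add: h zero_prod_def)
  have "(\<alpha>, \<beta>) \<in> h (\<alpha> + \<beta>)"
    using set_plus_intro[OF left[of \<alpha>] right[of \<beta>]] by (simp add: h)
  moreover have "h (\<alpha> + \<beta>) = d u v"
    unfolding eq[symmetric] using h \<open>u \<le> v\<close> by simp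
  ultimately show ?thesis
    by (auto simp: d_def)
qed

section \<open>The range of a Boolean Banaschewski function\<close>

text \<open>
  The dimension of a complement of \<open>x\<close> relative to \<open>z\<close> depends on \<open>x\<close> and \<open>z\<close> only; this is what
  allows one complement to be exchanged for another.
\<close>

lemma dim_of_direct_sum:
  assumes "direct_sum x y z"
  shows "dim_of y = dim_int x z"
  using assms dim_int_transpose[of x y] by (simp add: direct_sum_def dim_of_def)

text \<open>
  The splitting element \<open>t\<close> of \<open>x\<close> comes from the ambient lattice. The complement \<open>f t\<close> of \<open>t\<close> is in the
  range, and replacing \<open>t\<close> by the part of \<open>x\<close> outside \<open>f t\<close> changes neither of the two dimensions.
\<close>

lemma boolean_banaschewski_v_measure:
  fixes f :: "'a::bounded_lattice \<Rightarrow> 'a"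
  assumes L: "complemented TYPE('a)" "modular TYPE('a)" and f: "boolean_banaschewski f"
  shows "v_measure (range f) f dim_of"
proof -
  have ban: "banaschewski f" and bool: "boolean_sublattice (range f)"
    using f by (simp_all add: boolean_banaschewski_def)
  have compl: "direct_sum x (f x) top" for x
    using ban by (simp add: banaschewski_def)
  have closed: "inf x y \<in> range f" "sup x y \<in> range f" if "x \<in> range f" "y \<in> range f" for x y
    using bool that unfolding boolean_sublattice_def sublattice_def by blast+
  have distrib: "inf x (sup y z) = sup (inf x y) (inf x z)"
    if "x \<in> range f" "y \<in> range f" "z \<in> range f" for x y z
    using bool that unfolding boolean_sublattice_def by blast
  show ?thesis
  proof
    show "top \<in> range f"
      using banaschewski_bounds_in_range[OF ban] by (simp add: bounds_in_def)
    show "dim_of x = 0 \<longleftrightarrow> x = bot" for x :: 'a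
      using dim_int_eq_0_iff[of bot x] by (auto simp: dim_of_def)
    show "dim_of z = dim_of x + dim_of y" if "direct_sum x y z" for x y z :: 'a
    proof -
      have "x \<le> z"
        using that by (auto simp: direct_sum_def)
      then show ?thesis
        using dim_of_direct_sum[OF that] dim_int_split[of bot x z] by (simp add: dim_of_def)
    qed
  next
    fix x \<alpha> \<beta> assume x: "x \<in> range f" and "dim_of x = \<alpha> + \<beta>"
    then obtain t where t: "t \<le> x" "dim_of t = \<alpha>" "dim_int t x = \<beta>"
      using dim_int_sum_split[OF L, of bot x] by (auto simp: dim_of_def)
    define y z where "y = inf x (f (f t))" and "z = inf x (f t)"
    have "direct_sum z y x"
    proof -
      have "sup z y = inf x (sup (f t) (f (f t)))"
        using distrib[OF x, of "f t" "f (f t)"] by (simp add: y_def z_def)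
      moreover have "inf z y = inf x (inf (f t) (f (f t)))"
        by (simp add: y_def z_def inf.assoc inf.left_commute)
      ultimately show ?thesis
        using compl[of "f t"] by (simp add: direct_sum_def)
    qed
    moreover have "direct_sum t z x"
    proof -
      have "sup t (inf (f t) x) = inf (sup t (f t)) x"
        using L(2) t(1) by (simp add: modular_def)
      moreover have "inf t z = inf x (inf t (f t))"
        by (simp add: z_def inf.left_commute)
      ultimately show ?thesis
        using compl[of t] by (simp add: direct_sum_def z_def inf_commute)
    qed
    ultimately have "dim_of y = \<alpha>" "dim_of z = \<beta>" "direct_sum y z x"
      using t dim_of_direct_sum[of z y x] dim_of_direct_sum[of z t x] dim_of_direct_sum[of t z x]
      by (simp_all add: direct_sum_commute[of z])
    moreover have "y \<in> range f" "z \<in> range f"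
      using closed x by (simp_all add: y_def z_def)
    ultimately show "\<exists>y\<in>range f. \<exists>z\<in>range f. direct_sum y z x \<and> dim_of y = \<alpha> \<and> dim_of z = \<beta>"
      by blast
  qed (use closed distrib compl in auto)
qed

theorem corollary4p8:
  fixes f f' :: "'a::bounded_lattice \<Rightarrow> 'a"
  assumes "countable (UNIV :: 'a set)"
    and "complemented TYPE('a)"
    and "modular TYPE('a)"
    and "boolean_banaschewski f"
    and "boolean_banaschewski f'"
  shows "(\<exists>\<phi>. boolean_iso \<phi> (range f) (range f') \<and>
              (\<forall>x\<in>range f. dim_of (\<phi> x) = dim_of x)) \<and>
         (\<exists>\<phi>. boolean_iso \<phi> (range f) (range f'))"
proof -
  interpret v_measure_pair "range f" f dim_of "range f'" f' dim_of
    using assms(2-5) by (intro v_measure_pair.intro boolean_banaschewski_v_measure)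
  have "countable (range f)" "countable (range f')"
    using assms(1) by auto
  then show ?thesis
    using vaught by blast
qed

end
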